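(* Let $U^n,V^n\in\mathbb C_h^p$ ($0\le n\le N$) and $\Phi^{n+1/2},\Psi^{n+1/2}\in\mathbb R_h^p$ ($0\le n\le N-1$) be the solutions of the LRCD scheme (see context). Define the discrete masses $\mathcal M_u^n:=\|U^n\|^2$, $\mathcal M_v^n:=\|V^n\|^2$ for $0\le n\le N$; $\mathcal R_u^0:=(\Phi^0,1)$, $\mathcal R_v^0:=(\Psi^0,1)$, and for $1\le n\le N-1$ $$\mathcal R_u^n:=\tfrac12(\Phi^{n+1/2}+\Phi^{n-1/2},1),\qquad \mathcal R_v^n:=\tfrac12(\Psi^{n+1/2}+\Psi^{n-1/2},1).$$ Define the discrete energy by $$\mathcal E^0:=-\kappa\sum_{\chi=U,V}(\mathcal A_h^{-1}\Lambda_h\chi^0,\chi^0)-\tfrac12\big[(2\Phi^0-\Phi^{1/2},\Phi^{1/2})+(2\Psi^0-\Psi^{1/2},\Psi^{1/2})\big]-\tfrac{\beta}{2}\big[(2\Phi^0-\Phi^{1/2},\Psi^{1/2})+(2\Psi^0-\Psi^{1/2},\Phi^{1/2})\big],$$ for $1\le n\le N-1$, $$\mathcal E^n:=-\kappa\sum_{\chi=U,V}(\mathcal A_h^{-1}\Lambda_h\chi^n,\chi^n)-\tfrac12\sum_{\chi=\Phi,\Psi}(\chi^{n-1/2},\chi^{n+1/2})-\tfrac{\beta}{2}\big[(\Phi^{n-1/2},\Psi^{n+1/2})+(\Psi^{n-1/2},\Phi^{n+1/2})\big],$$ and $$\begin{aligned}\mathcal E^N:=&-\kappa\sum_{\chi=U,V}(\mathcal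 A_h^{-1}\Lambda_h\chi^N,\chi^N)-\tfrac12\big[(\Phi^{N-1/2},2|U^N|^2-\Phi^{N-1/2})+(\Psi^{N-1/2},2|V^N|^2-\Psi^{N-1/2})\big]\\&-\tfrac{\beta}{2}\big[(\Phi^{N-1/2},2|V^N|^2-\Psi^{N-1/2})+(\Psi^{N-1/2},2|U^N|^2-\Phi^{N-1/2})\big].\end{aligned}$$ Then the following conservation laws hold: $$\mathcal M_u^{n+1}=\mathcal M_u^0,\quad \mathcal M_v^{n+1}=\mathcal M_v^0,\quad \mathcal E^{n+1}=\mathcal E^0\qquad(0\le n\le N-1),$$ $$\mathcal R_u^{n+1}=\mathcal M_u^0,\quad \mathcal R_v^{n+1}=\mathcal M_v^0\qquad(0\le n\le N-2).$$
   Context: **Grids.** $\Omega=(x_l,x_r)\times(y_l,y_r)$, $T>0$, $\kappa,\beta\in\mathbb R$ constants. For positive integers $N,M_x,M_y$: $\tau=T/N$, $h_x=(x_r-x_l)/M_x$, $h_y=(y_r-y_l)/M_y$. $\mathbb C_h^p$ (resp. $\mathbb R_h^p$) is the space of complex (resp. real) grid functions $\{w_{i,j}\}_{0\le i\le M_x,0\le j\le M_y}$ with $w_{0,j}=w_{M_x,j}$, $w_{i,0}=w_{i,M_y}$, extended periodically in the indices. Products and $|\cdot|^2$ are pointwise; $1$ denotes the constant grid function. $\widetilde w^{n+1/2}=\frac{w^{n+1}+w^n}{2}$, $\delta_tw^{n+1}=\frac{w^{n+1}-w^n}{\tau}$. $(v,q)=h_xh_y\sum_{i=1}^{M_x}\sum_{j=1}^{M_y}v_{i,j}\bar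 q_{i,j}$, $\|v\|=\sqrt{(v,v)}$. **Operators.** $\delta_x^2w_{i,j}=\frac{w_{i+1,j}-2w_{i,j}+w_{i-1,j}}{h_x^2}$, $\mathcal A_xw_{i,j}=w_{i,j}+\frac{h_x^2}{12}\delta_x^2w_{i,j}$, similarly in $y$; $\mathcal A_h=\mathcal A_x\mathcal A_y$ (invertible on $\mathbb C_h^p$), $\Lambda_h=\mathcal A_y\delta_x^2+\mathcal A_x\delta_y^2$. **LRCD scheme** (for the coupled nonlinear Schrödinger system with periodic initial data $u^0,v^0$). $U^0=u^0$, $V^0=v^0$ (grid values), $\Phi^0=|u^0|^2$, $\Psi^0=|v^0|^2$. Step 1: $U^{1/2},V^{1/2}\in\mathbb C_h^p$ solve $\mathrm i\mathcal A_h\frac{U^{1/2}-U^0}{\tau/2}+\kappa\Lambda_h\frac{U^{1/2}+U^0}{2}+\mathcal A_h[(\Phi^0+\beta\Psi^0)\frac{U^{1/2}+U^0}{2}]=0$, $\mathrm i\mathcal A_h\frac{V^{1/2}-V^0}{\tau/2}+\kappa\Lambda_h\frac{V^{1/2}+V^0}{2}+\mathcal A_h[(\Psi^0+\beta\Phi^0)\frac{V^{1/2}+V^0}{2}]=0$. Step 2: $\Phi^{1/2}=|U^{1/2}|^2$, $\Psi^{1/2}=|V^{1/2}|^2$. Step 3: for $1\le n\le N-1$, $\Phi^{n+1/2}=2|U^n|^2-\Phi^{n-1/2}$, $\Psi^{n+1/2}=2|V^n|^2-\Psi^{n-1/2}$. For $0\le n\le N-1$, $U^{n+1},V^{n+1}\in\mathbb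 C_h^p$ solve $\mathrm i\mathcal A_h\delta_tU^{n+1}+\kappa\Lambda_h\widetilde U^{n+1/2}+\mathcal A_h[(\Phi^{n+1/2}+\beta\Psi^{n+1/2})\widetilde U^{n+1/2}]=0$, $\mathrm i\mathcal A_h\delta_tV^{n+1}+\kappa\Lambda_h\widetilde V^{n+1/2}+\mathcal A_h[(\Psi^{n+1/2}+\beta\Phi^{n+1/2})\widetilde V^{n+1/2}]=0$. *)

theory Defs
  imports Complex_Main
begin

text \<open>
  A grid function is kept together with its periodic extension, so the index set is all of
  \<open>\<int> \<times> \<int>\<close>. Real grid functions are the complex ones with values in \<open>\<real>\<close>, so
  that a single inner product serves both.
\<close>

type_synonym grid_fun = "int \<Rightarrow> int \<Rightarrow> complex"

definition cgrid :: "nat \<Rightarrow> nat \<Rightarrow> grid_fun set" where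
  "cgrid Mx My = {w. \<forall>i j. w (i + int Mx) j = w i j \<and> w i (j + int My) = w i j}"

definition rgrid :: "nat \<Rightarrow> nat \<Rightarrow> grid_fun set" where
  "rgrid Mx My = {w \<in> cgrid Mx My. \<forall>i j. w i j \<in> \<real>}"

definition grid_one :: grid_fun where
  "grid_one = (\<lambda>i j. 1)"

definition abs2 :: "grid_fun \<Rightarrow> grid_fun" where
  "abs2 w = (\<lambda>i j. complex_of_real ((cmod (w i j))\<^sup>2))"

definition reflect :: "grid_fun \<Rightarrow> grid_fun \<Rightarrow> grid_fun" where
  "reflect p q = (\<lambda>i j. 2 * p i j - q i j)"

definition grid_values ::
    "real \<Rightarrow> real \<Rightarrow> real \<Rightarrow> real \<Rightarrow> (real \<Rightarrow> real \<Rightarrow> complex) \<Rightarrow> grid_fun" where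
  "grid_values xl yl hx hy f = (\<lambda>i j. f (xl + of_int i * hx) (yl + of_int j * hy))"

definition ginner ::
    "nat \<Rightarrow> nat \<Rightarrow> real \<Rightarrow> real \<Rightarrow> grid_fun \<Rightarrow> grid_fun \<Rightarrow> complex" where
  "ginner Mx My hx hy v q =
     of_real (hx * hy) * (\<Sum>i = 1..int Mx. \<Sum>j = 1..int My. v i j * cnj (q i j))"

definition gnorm :: "nat \<Rightarrow> nat \<Rightarrow> real \<Rightarrow> real \<Rightarrow> grid_fun \<Rightarrow> real" where
  "gnorm Mx My hx hy v = sqrt (Re (ginner Mx My hx hy v v))"

definition delta_x2 :: "real \<Rightarrow> grid_fun \<Rightarrow> grid_fun" where
  "delta_x2 hx w = (\<lambda>i j. (w (i + 1) j - 2 * w i j + w (i - 1) j) / of_real (hx\<^sup>2))"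

definition delta_y2 :: "real \<Rightarrow> grid_fun \<Rightarrow> grid_fun" where
  "delta_y2 hy w = (\<lambda>i j. (w i (j + 1) - 2 * w i j + w i (j - 1)) / of_real (hy\<^sup>2))"

definition A_x :: "real \<Rightarrow> grid_fun \<Rightarrow> grid_fun" where
  "A_x hx w = (\<lambda>i j. w i j + of_real (hx\<^sup>2 / 12) * delta_x2 hx w i j)"

definition A_y :: "real \<Rightarrow> grid_fun \<Rightarrow> grid_fun" where
  "A_y hy w = (\<lambda>i j. w i j + of_real (hy\<^sup>2 / 12) * delta_y2 hy w i j)"

definition A_h :: "real \<Rightarrow> real \<Rightarrow> grid_fun \<Rightarrow> grid_fun" where
  "A_h hx hy w = A_x hx (A_y hy w)"

definition Lambda_h :: "real \<Rightarrow> real \<Rightarrow> grid_fun \<Rightarrow> grid_fun" where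
  "Lambda_h hx hy w = (\<lambda>i j. A_y hy (delta_x2 hx w) i j + A_x hx (delta_y2 hy w) i j)"

text \<open>The inverse is taken on the periodic grid functions, where \<open>A_h\<close> is a bijection.\<close>

definition A_h_inv :: "nat \<Rightarrow> nat \<Rightarrow> real \<Rightarrow> real \<Rightarrow> grid_fun \<Rightarrow> grid_fun" where
  "A_h_inv Mx My hx hy = inv_into (cgrid Mx My) (A_h hx hy)"

text \<open>
  One linear step from \<open>w\<close> to \<open>w'\<close> over a time increment \<open>s\<close>, with frozen
  potential \<open>p + \<beta> q\<close>. Both the predictor (\<open>s = \<tau> / 2\<close>) and the main
  steps (\<open>s = \<tau>\<close>) have this form.
\<close>

definition cn_step ::
    "real \<Rightarrow> real \<Rightarrow> real \<Rightarrow> real \<Rightarrow> real \<Rightarrow> grid_fun \<Rightarrow> grid_fun \<Rightarrow> grid_fun \<Rightarrow> grid_fun \<Rightarrow> bool"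
  where
  "cn_step \<kappa> \<beta> hx hy s p q w w' \<longleftrightarrow>
     (\<forall>i j. \<i> * A_h hx hy (\<lambda>k l. (w' k l - w k l) / of_real s) i j
          + of_real \<kappa> * Lambda_h hx hy (\<lambda>k l. (w' k l + w k l) / 2) i j
          + A_h hx hy (\<lambda>k l. (p k l + of_real \<beta> * q k l) * ((w' k l + w k l) / 2)) i j = 0)"

text \<open>
  Half-integer time levels: \<open>\<Phi> n\<close> and \<open>\<Psi> n\<close> stand for the values at level
  \<open>n + 1/2\<close>, while \<open>\<Phi>0\<close>, \<open>\<Psi>0\<close> are those at level \<open>0\<close>;
  \<open>Uh\<close>, \<open>Vh\<close> are the predictors at level \<open>1/2\<close>.
\<close>

definition lrcd_scheme ::
    "real \<Rightarrow> real \<Rightarrow> nat \<Rightarrow> real \<Rightarrow> nat \<Rightarrow> nat \<Rightarrow> real \<Rightarrow> real \<Rightarrow> grid_fun \<Rightarrow> grid_fun \<Rightarrow>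
     (nat \<Rightarrow> grid_fun) \<Rightarrow> (nat \<Rightarrow> grid_fun) \<Rightarrow> grid_fun \<Rightarrow> grid_fun \<Rightarrow>
     grid_fun \<Rightarrow> grid_fun \<Rightarrow> (nat \<Rightarrow> grid_fun) \<Rightarrow> (nat \<Rightarrow> grid_fun) \<Rightarrow> bool"
  where
  "lrcd_scheme \<kappa> \<beta> N \<tau> Mx My hx hy u0 v0 U V Uh Vh \<Phi>0 \<Psi>0 \<Phi> \<Psi> \<longleftrightarrow>
     (\<forall>n\<le>N. U n \<in> cgrid Mx My \<and> V n \<in> cgrid Mx My) \<and>
     (\<forall>n<N. \<Phi> n \<in> rgrid Mx My \<and> \<Psi> n \<in> rgrid Mx My) \<and>
     U 0 = u0 \<and> V 0 = v0 \<and> \<Phi>0 = abs2 u0 \<and> \<Psi>0 = abs2 v0 \<and>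
     Uh \<in> cgrid Mx My \<and> Vh \<in> cgrid Mx My \<and>
     cn_step \<kappa> \<beta> hx hy (\<tau> / 2) \<Phi>0 \<Psi>0 (U 0) Uh \<and>
     cn_step \<kappa> \<beta> hx hy (\<tau> / 2) \<Psi>0 \<Phi>0 (V 0) Vh \<and>
     \<Phi> 0 = abs2 Uh \<and> \<Psi> 0 = abs2 Vh \<and>
     (\<forall>n. 1 \<le> n \<and> n < N \<longrightarrow>
        \<Phi> n = reflect (abs2 (U n)) (\<Phi> (n - 1)) \<and> \<Psi> n = reflect (abs2 (V n)) (\<Psi> (n - 1))) \<and>
     (\<forall>n<N. cn_step \<kappa> \<beta> hx hy \<tau> (\<Phi> n) (\<Psi> n) (U n) (U (n + 1)) \<and>
            cn_step \<kappa> \<beta> hx hy \<tau> (\<Psi> n) (\<Phi> n) (V n) (V (n + 1)))"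

definition mass ::
    "nat \<Rightarrow> nat \<Rightarrow> real \<Rightarrow> real \<Rightarrow> (nat \<Rightarrow> grid_fun) \<Rightarrow> nat \<Rightarrow> real" where
  "mass Mx My hx hy W n = (gnorm Mx My hx hy (W n))\<^sup>2"

definition relaxed_mass ::
    "nat \<Rightarrow> nat \<Rightarrow> real \<Rightarrow> real \<Rightarrow> grid_fun \<Rightarrow> (nat \<Rightarrow> grid_fun) \<Rightarrow> nat \<Rightarrow> complex" where
  "relaxed_mass Mx My hx hy P0 P n =
     (if n = 0 then ginner Mx My hx hy P0 grid_one
      else 1 / 2 * ginner Mx My hx hy (\<lambda>i j. P n i j + P (n - 1) i j) grid_one)"

text \<open>
  The three energy formulas share one shape: \<open>p\<close>, \<open>q\<close> are the auxiliary fields at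
  level \<open>n - 1/2\<close> and \<open>p'\<close>, \<open>q'\<close> those at level \<open>n + 1/2\<close>; at
  \<open>n = 0\<close> the former, and at \<open>n = N\<close> the latter, are obtained by reflection.
\<close>

definition energy_form ::
    "real \<Rightarrow> real \<Rightarrow> nat \<Rightarrow> nat \<Rightarrow> real \<Rightarrow> real \<Rightarrow> grid_fun \<Rightarrow> grid_fun \<Rightarrow>
     grid_fun \<Rightarrow> grid_fun \<Rightarrow> grid_fun \<Rightarrow> grid_fun \<Rightarrow> complex"
  where
  "energy_form \<kappa> \<beta> Mx My hx hy u v p q p' q' =
     - of_real \<kappa> * (ginner Mx My hx hy (A_h_inv Mx My hx hy (Lambda_h hx hy u)) u
                   + ginner Mx My hx hy (A_h_inv Mx My hx hy (Lambda_h hx hy v)) v)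
     - 1 / 2 * (ginner Mx My hx hy p p' + ginner Mx My hx hy q q')
     - of_real (\<beta> / 2) * (ginner Mx My hx hy p q' + ginner Mx My hx hy q p')"

definition energy ::
    "real \<Rightarrow> real \<Rightarrow> nat \<Rightarrow> nat \<Rightarrow> nat \<Rightarrow> real \<Rightarrow> real \<Rightarrow> (nat \<Rightarrow> grid_fun) \<Rightarrow> (nat \<Rightarrow> grid_fun) \<Rightarrow>
     grid_fun \<Rightarrow> grid_fun \<Rightarrow> (nat \<Rightarrow> grid_fun) \<Rightarrow> (nat \<Rightarrow> grid_fun) \<Rightarrow> nat \<Rightarrow> complex"
  where
  "energy \<kappa> \<beta> N Mx My hx hy U V \<Phi>0 \<Psi>0 \<Phi> \<Psi> n =
     (if n = 0 then
        energy_form \<kappa> \<beta> Mx My hx hy (U 0) (V 0)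
          (reflect \<Phi>0 (\<Phi> 0)) (reflect \<Psi>0 (\<Psi> 0)) (\<Phi> 0) (\<Psi> 0)
      else if n < N then
        energy_form \<kappa> \<beta> Mx My hx hy (U n) (V n) (\<Phi> (n - 1)) (\<Psi> (n - 1)) (\<Phi> n) (\<Psi> n)
      else
        energy_form \<kappa> \<beta> Mx My hx hy (U N) (V N) (\<Phi> (N - 1)) (\<Psi> (N - 1))
          (reflect (abs2 (U N)) (\<Phi> (N - 1))) (reflect (abs2 (V N)) (\<Psi> (N - 1))))"

end

theory Submission
  imports Defs
begin

text \<open>
  Write \<open>L = A\<^sub>h\<^sup>-\<^sup>1 \<Lambda>\<^sub>h\<close>. The stencils are symmetric and commute, so \<open>L\<close> is self-adjoint, and every
  step of the scheme has the form \<open>\<i> (w' - w) / s + (\<kappa> L + P) (w' + w) / 2 = 0\<close> with a real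
  potential \<open>P\<close>. Pairing it with \<open>w' + w\<close> and taking imaginary parts gives mass conservation;
  pairing it with \<open>w' - w\<close> and taking real parts gives
  \<open>- \<kappa> (L w', w') + \<kappa> (L w, w) = (P, |w'|\<^sup>2 - |w|\<^sup>2)\<close>. The relaxation
  \<open>\<Phi>\<^sup>n\<^sup>+\<^sup>1\<^sup>/\<^sup>2 + \<Phi>\<^sup>n\<^sup>-\<^sup>1\<^sup>/\<^sup>2 = 2 |U\<^sup>n|\<^sup>2\<close> makes the right-hand side, summed over the two
  components, the increment of the remaining terms of the energy. Since the initial and final energies
  use reflected fields, this identity covers all steps uniformly.
\<close>

section \<open>Periodic sequences and summation by parts\<close>

lemma cgrid_iff:
  "w \<in> cgrid Mx My \<longleftrightarrow> (\<forall>i j. w (i + int Mx) j = w i j) \<and> (\<forall>i j. w i (j + int My) = w i j)"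
  by (auto simp: cgrid_def)

text \<open>At neighbouring nodes the period stands in the middle of the index, where the hypothesis
  does not match syntactically.\<close>

lemma periodic_shift:
  fixes w :: "int \<Rightarrow> 'a"
  assumes "\<And>i. w (i + m) = w i"
  shows "w (i + m + a) = w (i + a)" "w (i + m - a) = w (i - a)"
  using assms[of "i + a"] assms[of "i - a"] by (simp_all add: algebra_simps)

lemma sum_periodic_shift:
  fixes f :: "int \<Rightarrow> 'a::ab_group_add"
  assumes "\<And>i. f (i + int m) = f i"
  shows "(\<Sum>i = 1..int m. f (i + 1)) = (\<Sum>i = 1..int m. f i)"
proof -
  have "(\<Sum>i = 1..int m. f (i + 1)) = (\<Sum>i = 2..int m + 1. f i)"
    by (rule sum.reindex_bij_witness[of _ "\<lambda>i. i - 1" "\<lambda>i. i + 1"]) auto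
  also have "\<dots> = (\<Sum>i = 1..int m. f i)"
  proof (cases "m = 0")
    case False
    \<comment> \<open>The two ranges differ only in \<open>int m + 1\<close> against
      \<open>1\<close>, where \<open>f\<close> agrees. The splitting fails for \<open>m = 0\<close>,
      hence the case distinction.\<close>
    have "{2..int m + 1} = insert (int m + 1) {2..int m}" "{1..int m} = insert 1 {2..int m}"
      using False by auto
    then show ?thesis
      using assms[of 1] by (simp add: add.commute)
  qed simp
  finally show ?thesis .
qed

text \<open>Both summands come from one periodic sequence read at consecutive indices, so summation
  by parts leaves no boundary term.\<close>

lemma sum_periodic_transfer:
  fixes f g :: "int \<Rightarrow> 'a::comm_ring"
  assumes "\<And>i. f (i + int m) = f i" "\<And>i. g (i + int m) = g i"
  shows "(\<Sum>i = 1..int m. f (i + 1) * g i) = (\<Sum>i = 1..int m. f i * g (i - 1))"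
  using sum_periodic_shift[of "\<lambda>i. f i * g (i - 1)" m] periodic_shift[of f "int m"]
    periodic_shift[of g "int m"] assms
  by simp

text \<open>The transfer, applied to \<open>f\<close>, \<open>g\<close> and to \<open>g\<close>,
  \<open>f\<close>, exchanges the two outer terms. Conjugation enters only later, through the choice
  of \<open>g\<close>.\<close>

lemma sum_second_difference_symmetric:
  fixes f g :: "int \<Rightarrow> complex"
  assumes "\<And>i. f (i + int m) = f i" "\<And>i. g (i + int m) = g i"
  shows "(\<Sum>i = 1..int m. (f (i + 1) - 2 * f i + f (i - 1)) / c * g i) =
         (\<Sum>i = 1..int m. f i * ((g (i + 1) - 2 * g i + g (i - 1)) / c))"
proof -
  have "(\<Sum>i = 1..int m. (f (i + 1) - 2 * f i + f (i - 1)) * g i) =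
        (\<Sum>i = 1..int m. f i * (g (i + 1) - 2 * g i + g (i - 1)))"
    using sum_periodic_transfer[of f m g, OF assms] sum_periodic_transfer[of g m f, OF assms(2,1)]
    by (simp add: algebra_simps sum.distrib sum_subtractf)
  then show ?thesis
    by (simp add: sum_divide_distrib[symmetric])
qed

section \<open>Periodicity and linearity of the difference operators\<close>

lemma delta_x2_cgrid: "w \<in> cgrid Mx My \<Longrightarrow> delta_x2 h w \<in> cgrid Mx My"
  by (simp add: cgrid_iff delta_x2_def periodic_shift[where w = "\<lambda>i. w i _"])

lemma delta_y2_cgrid: "w \<in> cgrid Mx My \<Longrightarrow> delta_y2 h w \<in> cgrid Mx My"
  by (simp add: cgrid_iff delta_y2_def periodic_shift)

lemma A_x_cgrid: "w \<in> cgrid Mx My \<Longrightarrow> A_x h w \<in> cgrid Mx My"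
  using delta_x2_cgrid[of w Mx My h] by (simp add: cgrid_iff A_x_def)

lemma A_y_cgrid: "w \<in> cgrid Mx My \<Longrightarrow> A_y h w \<in> cgrid Mx My"
  using delta_y2_cgrid[of w Mx My h] by (simp add: cgrid_iff A_y_def)

lemma cgrid_lincomb:
  assumes "v \<in> cgrid Mx My" "w \<in> cgrid Mx My"
  shows "(\<lambda>i j. a * v i j + b * w i j) \<in> cgrid Mx My"
  using assms by (simp add: cgrid_iff)

lemma Lambda_h_cgrid: "w \<in> cgrid Mx My \<Longrightarrow> Lambda_h hx hy w \<in> cgrid Mx My"
  using cgrid_lincomb[of "A_y hy (delta_x2 hx w)" Mx My "A_x hx (delta_y2 hy w)" 1 1]
  by (simp add: Lambda_h_def A_x_cgrid A_y_cgrid delta_x2_cgrid delta_y2_cgrid)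

lemma rgrid_imp_cgrid: "w \<in> rgrid Mx My \<Longrightarrow> w \<in> cgrid Mx My"
  by (simp add: rgrid_def)

lemma delta_x2_lincomb:
  "delta_x2 h (\<lambda>i j. a * v i j + b * w i j) = (\<lambda>i j. a * delta_x2 h v i j + b * delta_x2 h w i j)"
  by (simp add: delta_x2_def fun_eq_iff add_divide_distrib diff_divide_distrib algebra_simps)

lemma delta_y2_lincomb:
  "delta_y2 h (\<lambda>i j. a * v i j + b * w i j) = (\<lambda>i j. a * delta_y2 h v i j + b * delta_y2 h w i j)"
  by (simp add: delta_y2_def fun_eq_iff add_divide_distrib diff_divide_distrib algebra_simps)

lemma A_x_lincomb:
  "A_x h (\<lambda>i j. a * v i j + b * w i j) = (\<lambda>i j. a * A_x h v i j + b * A_x h w i j)"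
  by (simp add: A_x_def delta_x2_lincomb fun_eq_iff algebra_simps)

lemma A_y_lincomb:
  "A_y h (\<lambda>i j. a * v i j + b * w i j) = (\<lambda>i j. a * A_y h v i j + b * A_y h w i j)"
  by (simp add: A_y_def delta_y2_lincomb fun_eq_iff algebra_simps)

lemma A_h_lincomb:
  "A_h hx hy (\<lambda>i j. a * v i j + b * w i j) = (\<lambda>i j. a * A_h hx hy v i j + b * A_h hx hy w i j)"
  by (simp add: A_h_def A_x_lincomb A_y_lincomb)

lemma Lambda_h_lincomb:
  "Lambda_h hx hy (\<lambda>i j. a * v i j + b * w i j) =
     (\<lambda>i j. a * Lambda_h hx hy v i j + b * Lambda_h hx hy w i j)"
  by (simp add: Lambda_h_def delta_x2_lincomb delta_y2_lincomb A_x_lincomb A_y_lincomb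
      fun_eq_iff algebra_simps)

section \<open>Commutation of the difference operators\<close>

lemma delta_y2_delta_x2: "delta_y2 hy (delta_x2 hx w) = delta_x2 hx (delta_y2 hy w)"
  by (simp add: delta_x2_def delta_y2_def fun_eq_iff add_divide_distrib diff_divide_distrib
      algebra_simps)

text \<open>The explicit factor \<open>1\<close> gives the right-hand side the exact shape of the
  linearity rules, so plain rewriting carries operators and inner products through it.\<close>

lemma A_x_lincomb_def: "A_x h w = (\<lambda>i j. 1 * w i j + of_real (h\<^sup>2 / 12) * delta_x2 h w i j)"
  by (simp add: A_x_def)

lemma A_y_lincomb_def: "A_y h w = (\<lambda>i j. 1 * w i j + of_real (h\<^sup>2 / 12) * delta_y2 h w i j)"
  by (simp add: A_y_def)

lemma delta_x2_A_x: "delta_x2 h (A_x h w) = A_x h (delta_x2 h w)"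
  by (simp only: A_x_lincomb_def delta_x2_lincomb)

lemma delta_y2_A_y: "delta_y2 h (A_y h w) = A_y h (delta_y2 h w)"
  by (simp only: A_y_lincomb_def delta_y2_lincomb)

lemma delta_x2_A_y: "delta_x2 hx (A_y hy w) = A_y hy (delta_x2 hx w)"
  by (simp only: A_y_lincomb_def delta_x2_lincomb delta_y2_delta_x2)

lemma delta_y2_A_x: "delta_y2 hy (A_x hx w) = A_x hx (delta_y2 hy w)"
  by (simp only: A_x_lincomb_def delta_y2_lincomb delta_y2_delta_x2)

lemma A_y_A_x: "A_y hy (A_x hx w) = A_x hx (A_y hy w)"
  by (simp only: A_x_lincomb_def A_y_lincomb delta_x2_A_y)

text \<open>Both operators are composed of commuting stencils. This commutation lets the composite
  with the inverse of \<open>A_h\<close> inherit symmetry.\<close>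

lemma Lambda_h_A_h: "Lambda_h hx hy (A_h hx hy w) = A_h hx hy (Lambda_h hx hy w)"
proof -
  have "A_h hx hy (Lambda_h hx hy w) =
      (\<lambda>i j. A_h hx hy (A_y hy (delta_x2 hx w)) i j + A_h hx hy (A_x hx (delta_y2 hy w)) i j)"
    using A_h_lincomb[of hx hy 1 "A_y hy (delta_x2 hx w)" 1 "A_x hx (delta_y2 hy w)"]
    by (simp add: Lambda_h_def)
  then show ?thesis
    unfolding Lambda_h_def[of _ _ "A_h hx hy w"]
    by (simp add: A_h_def delta_x2_A_x delta_x2_A_y delta_y2_A_x delta_y2_A_y A_y_A_x)
qed

section \<open>The inner product and symmetry of the operators\<close>

lemma ginner_lincomb_left:
  "ginner Mx My hx hy (\<lambda>i j. a * v i j + b * w i j) q =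
     a * ginner Mx My hx hy v q + b * ginner Mx My hx hy w q"
  by (simp add: ginner_def algebra_simps sum.distrib sum_distrib_left)

lemma cnj_ginner: "cnj (ginner Mx My hx hy v w) = ginner Mx My hx hy w v"
  by (simp add: ginner_def mult.commute)

lemma ginner_lincomb_right:
  "ginner Mx My hx hy q (\<lambda>i j. a * v i j + b * w i j) =
     cnj a * ginner Mx My hx hy q v + cnj b * ginner Mx My hx hy q w"
  by (simp add: ginner_def algebra_simps sum.distrib sum_distrib_left)

lemma ginner_zero_left: "ginner Mx My hx hy (\<lambda>i j. 0) q = 0"
  by (simp add: ginner_def)

lemma ginner_commute_rgrid:
  assumes "p \<in> rgrid Mx My" "q \<in> rgrid Mx My"
  shows "ginner Mx My hx hy p q = ginner Mx My hx hy q p"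
  using assms by (simp add: ginner_def rgrid_def Reals_cnj_iff mult.commute)

lemma ginner_delta_x2:
  assumes "v \<in> cgrid Mx My" "w \<in> cgrid Mx My"
  shows "ginner Mx My hx hy (delta_x2 h v) w = ginner Mx My hx hy v (delta_x2 h w)"
proof -
  have "(\<Sum>i = 1..int Mx. delta_x2 h v i j * cnj (w i j)) =
        (\<Sum>i = 1..int Mx. v i j * cnj (delta_x2 h w i j))" for j
    using sum_second_difference_symmetric[of "\<lambda>i. v i j" Mx "\<lambda>i. cnj (w i j)"] assms
    by (simp add: delta_x2_def cgrid_iff)
  \<comment> \<open>Summation by parts acts in \<open>i\<close> for fixed \<open>j\<close>, whereas
    \<open>ginner\<close> sums over \<open>j\<close> first; the sums must be exchanged.\<close>
  then have "(\<Sum>j = 1..int My. \<Sum>i = 1..int Mx. delta_x2 h v i j * cnj (w i j)) =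
      (\<Sum>j = 1..int My. \<Sum>i = 1..int Mx. v i j * cnj (delta_x2 h w i j))"
    by simp
  then show ?thesis
    unfolding ginner_def by (subst (1 2) sum.swap) simp
qed

lemma ginner_delta_y2:
  assumes "v \<in> cgrid Mx My" "w \<in> cgrid Mx My"
  shows "ginner Mx My hx hy (delta_y2 h v) w = ginner Mx My hx hy v (delta_y2 h w)"
proof -
  have "(\<Sum>j = 1..int My. delta_y2 h v i j * cnj (w i j)) =
        (\<Sum>j = 1..int My. v i j * cnj (delta_y2 h w i j))" for i
    using sum_second_difference_symmetric[of "\<lambda>j. v i j" My "\<lambda>j. cnj (w i j)"] assms
    by (simp add: delta_y2_def cgrid_iff)
  then show ?thesis
    by (simp add: ginner_def)
qed

lemma ginner_A_x:
  assumes "v \<in> cgrid Mx My" "w \<in> cgrid Mx My"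
  shows "ginner Mx My hx hy (A_x h v) w = ginner Mx My hx hy v (A_x h w)"
  unfolding A_x_lincomb_def ginner_lincomb_left ginner_lincomb_right
  using assms by (simp add: ginner_delta_x2)

lemma ginner_A_y:
  assumes "v \<in> cgrid Mx My" "w \<in> cgrid Mx My"
  shows "ginner Mx My hx hy (A_y h v) w = ginner Mx My hx hy v (A_y h w)"
  unfolding A_y_lincomb_def ginner_lincomb_left ginner_lincomb_right
  using assms by (simp add: ginner_delta_y2)

text \<open>Moving the factors across one at a time reverses their order; their commutation restores
  it.\<close>

lemma ginner_A_h:
  assumes "v \<in> cgrid Mx My" "w \<in> cgrid Mx My"
  shows "ginner Mx My kx ky (A_h hx hy v) w = ginner Mx My kx ky v (A_h hx hy w)"
  using assms by (simp add: A_h_def ginner_A_x ginner_A_y A_x_cgrid A_y_cgrid A_y_A_x)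

lemma ginner_Lambda_h:
  assumes "v \<in> cgrid Mx My" "w \<in> cgrid Mx My"
  shows "ginner Mx My kx ky (Lambda_h hx hy v) w = ginner Mx My kx ky v (Lambda_h hx hy w)"
proof -
  have sum_left: "ginner Mx My kx ky (\<lambda>i j. f i j + g i j) q =
      ginner Mx My kx ky f q + ginner Mx My kx ky g q"
    and sum_right: "ginner Mx My kx ky q (\<lambda>i j. f i j + g i j) =
      ginner Mx My kx ky q f + ginner Mx My kx ky q g" for f g q
    using ginner_lincomb_left[of Mx My kx ky 1 f 1 g q]
      ginner_lincomb_right[of Mx My kx ky q 1 f 1 g] by simp_all
  show ?thesis
    using assms
    by (simp add: Lambda_h_def sum_left sum_right ginner_A_x ginner_A_y ginner_delta_x2
        ginner_delta_y2 delta_x2_cgrid delta_y2_cgrid A_x_cgrid A_y_cgrid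
        delta_x2_A_y delta_y2_A_x)
qed

section \<open>Invertibility of the compact operators\<close>

text \<open>
  On \<open>m\<close>-periodic sequences the shift \<open>S\<close> satisfies \<open>S\<^sup>m = 1\<close>, so the truncated geometric series of
  \<open>r S\<close> inverts \<open>1 - r S\<close> up to the factor \<open>1 - r\<^sup>m\<close>.
\<close>

lemma periodic_first_order_solvable:
  fixes f :: "int \<Rightarrow> complex"
  assumes "\<And>i. f (i + int m) = f i" "r ^ m \<noteq> 1"
  defines "w \<equiv> \<lambda>i. (\<Sum>k<m. r ^ k * f (i + int k)) / (1 - r ^ m)"
  shows "w i - r * w (i + 1) = f i" "w (i + int m) = w i"
proof -
  let ?t = "\<lambda>k. r ^ k * f (i + int k)"
  \<comment> \<open>The factor \<open>r\<close> raises the summation index by one, so the difference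
    telescopes; periodicity identifies the two end terms up to \<open>r ^ m\<close>.\<close>
  have "r * (\<Sum>k<m. r ^ k * f (i + 1 + int k)) = (\<Sum>k<m. ?t (Suc k))"
    by (simp add: sum_distrib_left algebra_simps)
  then have "(\<Sum>k<m. ?t k) - r * (\<Sum>k<m. r ^ k * f (i + 1 + int k)) = (\<Sum>k<m. ?t k - ?t (Suc k))"
    by (simp only: sum_subtractf)
  also have "\<dots> = ?t 0 - ?t m"
    by (rule sum_lessThan_telescope')
  also have "\<dots> = (1 - r ^ m) * f i"
    using assms(1) by (simp add: algebra_simps)
  finally have "(\<Sum>k<m. ?t k) - r * (\<Sum>k<m. r ^ k * f (i + 1 + int k)) = (1 - r ^ m) * f i" .
  then show "w i - r * w (i + 1) = f i"
    using assms(2) by (simp add: w_def divide_simps)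
  show "w (i + int m) = w i"
    by (simp add: w_def periodic_shift[where w = f, OF assms(1)])
qed

text \<open>
  For \<open>r = - 5 + \<surd>24\<close>, a root of \<open>r\<^sup>2 + 10 r + 1\<close>, the stencil factors as
  \<open>S + 10 + S\<^sup>-\<^sup>1 = - (1 - r S) (1 - r S\<^sup>-\<^sup>1) / r\<close>; the second factor is handled by reversing
  the sequence. The solution operator is written as a function of the data, so that in two dimensions
  it also preserves periodicity in the other variable.
\<close>

lemma periodic_stencil_solvable:
  assumes "m > 0"
  shows "\<exists>R :: (int \<Rightarrow> complex) \<Rightarrow> int \<Rightarrow> complex. \<forall>f. (\<forall>i. f (i + int m) = f i) \<longrightarrow>
    (\<forall>i. (R f (i + 1) + 10 * R f i + R f (i - 1)) / 12 = f i \<and> R f (i + int m) = R f i)"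
proof -
  define \<rho> :: real where "\<rho> = sqrt 24 - 5"
  define r where "r = complex_of_real \<rho>"
  \<comment> \<open>This places \<open>\<rho>\<close> strictly between -1 and 0, so
    \<open>r ^ m\<close> has norm below 1 and the series can be normalised.\<close>
  have "4 < sqrt (24::real)" "sqrt (24::real) < 5"
    by (rule real_less_rsqrt, simp) (rule real_less_lsqrt, simp_all)
  then have \<rho>: "\<bar>\<rho>\<bar> < 1" "\<rho> \<noteq> 0"
    by (auto simp: \<rho>_def)
  have "r\<^sup>2 + 10 * r + 1 = of_real (\<rho>\<^sup>2 + 10 * \<rho> + 1)"
    by (simp add: r_def)
  also have "\<rho>\<^sup>2 + 10 * \<rho> + 1 = 0"
    by (simp add: \<rho>_def power2_diff)
  finally have root: "r\<^sup>2 + 10 * r + 1 = 0"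
    by simp
  have "norm (r ^ m) < 1"
    using power_strict_mono[of "norm r" 1 m] \<rho> assms by (simp add: r_def norm_power)
  then have rm: "r ^ m \<noteq> 1"
    by auto
  have r0: "r \<noteq> 0"
    using \<rho> by (simp add: r_def)
  define G where "G = (\<lambda>f i. (\<Sum>k<m. r ^ k * f (i + int k)) / (1 - r ^ m))"
  have G: "G f i - r * G f (i + 1) = f i" "G f (i + int m) = G f i"
    if "\<And>i. f (i + int m) = f i" for f i
    unfolding G_def using periodic_first_order_solvable[of f m r i] that rm by auto
  \<comment> \<open>The inner \<open>G\<close> inverts one factor, the outer \<open>G\<close> on the
    reversed sequence the other. The constant \<open>- 12 * r\<close> undoes the factor -1/r of the
    factorisation and the 1/12 of the stencil.\<close>
  define R where "R = (\<lambda>f i. G (\<lambda>i. - 12 * r * G f (- i)) (- i))"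
  have R: "(R f (i + 1) + 10 * R f i + R f (i - 1)) / 12 = f i \<and> R f (i + int m) = R f i"
    if f: "\<And>i. f (i + int m) = f i" for f i
  proof -
    let ?g = "\<lambda>i. - 12 * r * G f (- i)"
    have g: "?g (i + int m) = ?g i" for i
      using G(2)[of f "- i - int m", OF f] by simp
    have half_step: "R f i - r * R f (i - 1) = - 12 * r * G f i" for i
      using G(1)[of ?g "- i", OF g] by (simp add: R_def)
    \<comment> \<open>Splitting off the characteristic polynomial, which vanishes at
      \<open>r\<close>, leaves only \<open>half_step\<close> at \<open>i\<close> and
      \<open>i + 1\<close>.\<close>
    have "- r * (R f (i + 1) + 10 * R f i + R f (i - 1)) =
        (R f i - r * R f (i - 1)) - r * (R f (i + 1) - r * R f i)
        - (r\<^sup>2 + 10 * r + 1) * R f i"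
      by (simp add: algebra_simps power2_eq_square)
    also have "\<dots> = - 12 * r * (G f i - r * G f (i + 1))"
      using half_step[of i] half_step[of "i + 1"] by (simp add: root right_diff_distrib)
    also have "\<dots> = - 12 * r * f i"
      using G(1)[of f i, OF f] by simp
    finally have "R f (i + 1) + 10 * R f i + R f (i - 1) = 12 * f i"
      using r0 by (simp add: mult.assoc)
    moreover have "R f (i + int m) = R f i"
      using G(2)[of ?g "- i - int m", OF g] by (simp add: R_def)
    ultimately show ?thesis
      by simp
  qed
  show ?thesis
    using R by blast
qed

text \<open>The powers of \<open>h\<close> cancel, leaving the fixed stencil inverted above. For
  \<open>h = 0\<close>, division by zero would make \<open>A_x\<close> the identity.\<close>

lemma A_x_eq:
  assumes "h \<noteq> 0"
  shows "A_x h w i j = (w (i + 1) j + 10 * w i j + w (i - 1) j) / 12"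
  using assms by (simp add: A_x_def delta_x2_def field_simps)

lemma A_y_eq:
  assumes "h \<noteq> 0"
  shows "A_y h w i j = (w i (j + 1) + 10 * w i j + w i (j - 1)) / 12"
  using assms by (simp add: A_y_def delta_y2_def field_simps)

lemma A_x_surj:
  assumes "Mx > 0" "h \<noteq> 0" "f \<in> cgrid Mx My"
  obtains w where "w \<in> cgrid Mx My" "A_x h w = f"
proof -
  obtain R :: "(int \<Rightarrow> complex) \<Rightarrow> int \<Rightarrow> complex"
    where "\<forall>f. (\<forall>i. f (i + int Mx) = f i) \<longrightarrow>
      (\<forall>i. (R f (i + 1) + 10 * R f i + R f (i - 1)) / 12 = f i \<and> R f (i + int Mx) = R f i)"
    using periodic_stencil_solvable[OF assms(1)] by blast
  then have R: "(R f (i + 1) + 10 * R f i + R f (i - 1)) / 12 = f i" "R f (i + int Mx) = R f i"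
    if "\<And>i. f (i + int Mx) = f i" for f i
    using that by blast+
  show thesis
    by (rule that[of "\<lambda>i j. R (\<lambda>k. f k j) i"])
      (use assms in \<open>simp_all add: R A_x_eq cgrid_iff fun_eq_iff\<close>)
qed

lemma A_y_surj:
  assumes "My > 0" "h \<noteq> 0" "f \<in> cgrid Mx My"
  obtains w where "w \<in> cgrid Mx My" "A_y h w = f"
proof -
  obtain R :: "(int \<Rightarrow> complex) \<Rightarrow> int \<Rightarrow> complex"
    where "\<forall>f. (\<forall>i. f (i + int My) = f i) \<longrightarrow>
      (\<forall>i. (R f (i + 1) + 10 * R f i + R f (i - 1)) / 12 = f i \<and> R f (i + int My) = R f i)"
    using periodic_stencil_solvable[OF assms(1)] by blast
  then have R: "(R f (i + 1) + 10 * R f i + R f (i - 1)) / 12 = f i" "R f (i + int My) = R f i"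
    if "\<And>i. f (i + int My) = f i" for f i
    using that by blast+
  \<comment> \<open>An equality of whole rows: equal data give equal values of \<open>R\<close>,
    hence periodicity in the first index.\<close>
  have "f (i + int Mx) = f i" for i
    using assms by (simp add: cgrid_iff fun_eq_iff)
  then show thesis
    by (intro that[of "\<lambda>i. R (f i)"])
      (use assms in \<open>simp_all add: R A_y_eq cgrid_iff
          fun_eq_iff[of "A_y _ _"] fun_eq_iff[of "A_y _ _ _"]\<close>)
qed

lemma A_h_surj:
  assumes "Mx > 0" "My > 0" "hx \<noteq> 0" "hy \<noteq> 0" "f \<in> cgrid Mx My"
  obtains w where "w \<in> cgrid Mx My" "A_h hx hy w = f"
proof -
  obtain g where "g \<in> cgrid Mx My" "A_x hx g = f"
    using A_x_surj assms by metis
  moreover from this obtain w where "w \<in> cgrid Mx My" "A_y hy w = g"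
    using A_y_surj assms by metis
  ultimately show thesis
    using that by (auto simp: A_h_def)
qed

text \<open>By surjectivity \<open>inv_into\<close> picks a genuine periodic preimage. All later
  facts about \<open>A_h_inv\<close> rest on this right inverse property.\<close>

lemma A_h_inv_cgrid:
  assumes "Mx > 0" "My > 0" "hx \<noteq> 0" "hy \<noteq> 0" "f \<in> cgrid Mx My"
  shows "A_h_inv Mx My hx hy f \<in> cgrid Mx My" "A_h hx hy (A_h_inv Mx My hx hy f) = f"
proof -
  have "f \<in> A_h hx hy ` cgrid Mx My"
    using A_h_surj[OF assms] by blast
  then show "A_h_inv Mx My hx hy f \<in> cgrid Mx My" "A_h hx hy (A_h_inv Mx My hx hy f) = f"
    unfolding A_h_inv_def by (simp_all only: inv_into_into f_inv_into_f)
qed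

section \<open>Self-adjointness of the composite operator\<close>

lemma ginner_A_h_inv_Lambda_h:
  assumes "Mx > 0" "My > 0" "hx \<noteq> 0" "hy \<noteq> 0" "u \<in> cgrid Mx My" "z \<in> cgrid Mx My"
  shows "ginner Mx My kx ky (A_h_inv Mx My hx hy (Lambda_h hx hy u)) (A_h hx hy z) =
         ginner Mx My kx ky (Lambda_h hx hy u) z"
  using assms A_h_inv_cgrid[OF assms(1-4) Lambda_h_cgrid[OF assms(5)]]
  by (simp add: ginner_A_h[symmetric])

text \<open>With both arguments written as images under \<open>A_h\<close>, the inverses cancel;
  symmetry of \<open>A_h\<close> and \<open>Lambda_h\<close> and their commutation do the
  rest.\<close>

lemma ginner_A_h_inv_Lambda_h_symmetric:
  assumes "Mx > 0" "My > 0" "hx \<noteq> 0" "hy \<noteq> 0" "u \<in> cgrid Mx My" "w \<in> cgrid Mx My"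
  shows "ginner Mx My kx ky (A_h_inv Mx My hx hy (Lambda_h hx hy u)) w =
         ginner Mx My kx ky u (A_h_inv Mx My hx hy (Lambda_h hx hy w))"
proof -
  obtain z where z: "z \<in> cgrid Mx My" "w = A_h hx hy z"
    using A_h_surj assms by metis
  obtain y where y: "y \<in> cgrid Mx My" "u = A_h hx hy y"
    using A_h_surj assms by metis
  note L = A_h_inv_cgrid[OF assms(1-4) Lambda_h_cgrid[OF assms(6)]]
  have "ginner Mx My kx ky u (A_h_inv Mx My hx hy (Lambda_h hx hy w)) =
        ginner Mx My kx ky y (Lambda_h hx hy w)"
    using y L by (simp add: ginner_A_h)
  also have "\<dots> = ginner Mx My kx ky u (Lambda_h hx hy z)"
    using y z by (simp add: Lambda_h_A_h ginner_A_h Lambda_h_cgrid)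
  also have "\<dots> = ginner Mx My kx ky (Lambda_h hx hy u) z"
    using assms(5) z by (simp add: ginner_Lambda_h)
  finally show ?thesis
    using ginner_A_h_inv_Lambda_h[OF assms(1-5) z(1)] z(2) by simp
qed

section \<open>Conservation over one linear step\<close>

text \<open>Pairing the scheme with \<open>z\<close>, where \<open>A_h z = v\<close>, and moving
  \<open>A_h\<close> across amounts to applying the inverse of \<open>A_h\<close> to the scheme and
  testing with \<open>v\<close>.\<close>

lemma cn_step_weak:
  assumes "Mx > 0" "My > 0" "hx \<noteq> 0" "hy \<noteq> 0"
    and cgrid: "w \<in> cgrid Mx My" "w' \<in> cgrid Mx My" "v \<in> cgrid Mx My"
      "p \<in> cgrid Mx My" "q \<in> cgrid Mx My"
    and step: "cn_step \<kappa> \<beta> hx hy s p q w w'"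
  defines "L \<equiv> \<lambda>u. A_h_inv Mx My hx hy (Lambda_h hx hy u)"
    and "P \<equiv> \<lambda>i j. p i j + of_real \<beta> * q i j"
  shows "\<i> / of_real s * (ginner Mx My kx ky w' v - ginner Mx My kx ky w v)
       + of_real \<kappa> / 2 * (ginner Mx My kx ky (L w') v + ginner Mx My kx ky (L w) v)
       + 1 / 2 * (ginner Mx My kx ky (\<lambda>i j. P i j * w' i j) v
                + ginner Mx My kx ky (\<lambda>i j. P i j * w i j) v) = 0"
proof -
  let ?G = "ginner Mx My kx ky"
  obtain z where z: "z \<in> cgrid Mx My" "v = A_h hx hy z"
    using A_h_surj assms by metis
  define D where "D = (\<lambda>i j. (1 / of_real s) * w' i j + (- 1 / of_real s) * w i j)"
  define H where "H = (\<lambda>i j. (1 / 2) * w' i j + (1 / 2) * w i j)"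
  define PH where "PH = (\<lambda>i j. (1 / 2) * (P i j * w' i j) + (1 / 2) * (P i j * w i j))"
  have mem: "D \<in> cgrid Mx My" "H \<in> cgrid Mx My" "PH \<in> cgrid Mx My"
    using cgrid by (simp_all add: D_def H_def PH_def P_def cgrid_iff)
  have "(\<lambda>k l. (w' k l - w k l) / of_real s) = D" "(\<lambda>k l. (w' k l + w k l) / 2) = H"
    "(\<lambda>k l. (p k l + of_real \<beta> * q k l) * ((w' k l + w k l) / 2)) = PH"
    by (simp_all add: D_def H_def PH_def P_def fun_eq_iff add_divide_distrib diff_divide_distrib
        ring_distribs)
  then have "?G (\<lambda>i j. 1 * (\<i> * A_h hx hy D i j + of_real \<kappa> * Lambda_h hx hy H i j) + 1 * A_h hx hy PH i j) z
      = ?G (\<lambda>i j. 0) z"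
    using step by (simp add: cn_step_def)
  then have "1 * (\<i> * ?G (A_h hx hy D) z + of_real \<kappa> * ?G (Lambda_h hx hy H) z)
      + 1 * ?G (A_h hx hy PH) z = 0"
    unfolding ginner_lincomb_left ginner_zero_left .
  moreover have "?G (Lambda_h hx hy H) z = 1 / 2 * ?G (L w') v + 1 / 2 * ?G (L w) v"
    unfolding H_def Lambda_h_lincomb ginner_lincomb_left z(2) L_def
    using assms(1-4) cgrid z(1) by (simp add: ginner_A_h_inv_Lambda_h)
  moreover have "?G (A_h hx hy D) z = 1 / of_real s * ?G w' v + (- 1 / of_real s) * ?G w v"
    using mem z by (simp only: ginner_A_h) (simp only: D_def ginner_lincomb_left)
  moreover have "?G (A_h hx hy PH) z =
      1 / 2 * ?G (\<lambda>i j. P i j * w' i j) v + 1 / 2 * ?G (\<lambda>i j. P i j * w i j) v"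
    using mem z by (simp only: ginner_A_h) (simp only: PH_def ginner_lincomb_left)
  ultimately show ?thesis
    by (simp add: algebra_simps diff_divide_distrib)
qed

text \<open>The density \<open>abs2 w\<close> is real, so it can stand in the second argument
  without a conjugate.\<close>

lemma ginner_mult_self:
  "ginner Mx My hx hy (\<lambda>i j. P i j * w i j) w = ginner Mx My hx hy P (abs2 w)"
  unfolding ginner_def abs2_def complex_cnj_complex_of_real complex_norm_square
  by (simp add: mult_ac)

lemma cn_step_conservation:
  assumes pos: "Mx > 0" "My > 0" "hx \<noteq> 0" "hy \<noteq> 0" "s \<noteq> 0"
    and w: "w \<in> cgrid Mx My" "w' \<in> cgrid Mx My"
    and pq: "p \<in> rgrid Mx My" "q \<in> rgrid Mx My"
    and step: "cn_step \<kappa> \<beta> hx hy s p q w w'"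
  defines "L \<equiv> \<lambda>u. A_h_inv Mx My hx hy (Lambda_h hx hy u)"
    and "P \<equiv> \<lambda>i j. p i j + of_real \<beta> * q i j"
  shows "ginner Mx My kx ky w' w' = ginner Mx My kx ky w w"
    and "of_real \<kappa> * (ginner Mx My kx ky (L w') w' - ginner Mx My kx ky (L w) w) =
         ginner Mx My kx ky P (abs2 w) - ginner Mx My kx ky P (abs2 w')"
proof -
  let ?G = "ginner Mx My kx ky"
  let ?P = "\<lambda>u v. ?G (\<lambda>i j. P i j * u i j) v"
  have G: "cnj (?G u v) = ?G v u" for u v
    by (rule cnj_ginner)
  have K: "cnj (?G (L u) v) = ?G (L v) u" if "u \<in> cgrid Mx My" "v \<in> cgrid Mx My" for u v
    using ginner_A_h_inv_Lambda_h_symmetric[OF pos(1-4) that, of kx ky]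
    unfolding L_def by (simp add: G)
  have "cnj (P i j) = P i j" for i j
    using pq by (simp add: P_def rgrid_def Reals_cnj_iff)
  then have P: "cnj (?P u v) = ?P v u" for u v
    by (simp add: ginner_def algebra_simps)
  have weak: "\<i> / of_real s * (?G w' v - ?G w v) + of_real \<kappa> / 2 * (?G (L w') v + ?G (L w) v)
       + 1 / 2 * (?P w' v + ?P w v) = 0" if "v \<in> cgrid Mx My" for v
    unfolding L_def P_def using pos(1-4) w that pq(1,2)[THEN rgrid_imp_cgrid] step
    by (rule cn_step_weak)
  \<comment> \<open>Hermitian symmetry of the three forms makes the diagonal values real and leaves
    \<open>c\<close>, \<open>kc\<close>, \<open>pc\<close> and their conjugates as the only mixed
    values.\<close>
  define a b c where "a = ?G w' w'" and "b = ?G w w" and "c = ?G w' w"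
  define ka kb kc where "ka = ?G (L w') w'" and "kb = ?G (L w) w" and "kc = ?G (L w') w"
  define pa pb pc where "pa = ?P w' w'" and "pb = ?P w w" and "pc = ?P w' w"
  have im: "Im a = 0" "Im b = 0" "Im ka = 0" "Im kb = 0" "Im pa = 0" "Im pb = 0"
    using G[of w' w'] G[of w w] K[OF w(2,2)] K[OF w(1,1)] P[of w' w'] P[of w w]
    by (simp_all add: a_def b_def ka_def kb_def pa_def pb_def complex_eq_iff)
  have e': "\<i> / of_real s * (a - cnj c) + of_real \<kappa> / 2 * (ka + cnj kc) + 1 / 2 * (pa + cnj pc) = 0"
    using weak[OF w(2)] G[of w' w] K[OF w(2,1)] P[of w' w]
    by (simp add: a_def c_def ka_def kc_def pa_def pc_def)
  have e: "\<i> / of_real s * (c - b) + of_real \<kappa> / 2 * (kc + kb) + 1 / 2 * (pc + pb) = 0"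
    using weak[OF w(1)]
    by (simp add: b_def c_def kb_def kc_def pb_def pc_def)
  define t where "t = 1 / s"
  have i_div: "\<i> / of_real s = \<i> * of_real t"
    by (simp add: t_def)
  \<comment> \<open>Adding the imaginary parts of the equations tested with \<open>w'\<close> and
    \<open>w\<close> cancels all mixed values.\<close>
  have "t * (Re a - Re b) = 0"
    using arg_cong[OF e, of Im] arg_cong[OF e', of Im] im unfolding i_div
    by (simp add: algebra_simps)
  then show "?G w' w' = ?G w w"
    using im pos(5) by (simp add: t_def a_def b_def complex_eq_iff)
  \<comment> \<open>Subtracting the real parts cancels them too, including the contribution of
    \<open>Im c\<close> from the time difference.\<close>
  have "\<kappa> * (Re ka - Re kb) = Re pb - Re pa"
    using arg_cong[OF e, of Re] arg_cong[OF e', of Re] im unfolding i_div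
    by (simp add: field_simps)
  then have "of_real \<kappa> * (ka - kb) = pb - pa"
    using im by (simp add: complex_eq_iff)
  then show "of_real \<kappa> * (?G (L w') w' - ?G (L w) w) = ?G P (abs2 w) - ?G P (abs2 w')"
    by (simp add: ka_def kb_def pa_def pb_def ginner_mult_self)
qed

section \<open>Reflected fields and the energy balance\<close>

lemma abs2_rgrid: "w \<in> cgrid Mx My \<Longrightarrow> abs2 w \<in> rgrid Mx My"
  by (simp add: abs2_def rgrid_def cgrid_iff)

lemma reflect_rgrid: "p \<in> rgrid Mx My \<Longrightarrow> q \<in> rgrid Mx My \<Longrightarrow> reflect p q \<in> rgrid Mx My"
  by (simp add: reflect_def rgrid_def cgrid_iff)

lemma ginner_reflect_right:
  "ginner Mx My hx hy r (reflect p q) = 2 * ginner Mx My hx hy r p - ginner Mx My hx hy r q"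
  using ginner_lincomb_right[of Mx My hx hy r 2 p "-1" q] by (simp add: reflect_def)

text \<open>Reflection makes the terms quadratic in \<open>p\<close>, \<open>q\<close> equal on both
  sides. The remaining density increments, including the crossed ones with \<open>\<beta>\<close>,
  cancel the kinetic increments of the two components.\<close>

lemma energy_form_step:
  assumes pos: "Mx > 0" "My > 0" "hx \<noteq> 0" "hy \<noteq> 0" "s \<noteq> 0"
    and uv: "u \<in> cgrid Mx My" "v \<in> cgrid Mx My" "u' \<in> cgrid Mx My" "v' \<in> cgrid Mx My"
    and pq: "p \<in> rgrid Mx My" "q \<in> rgrid Mx My"
    and step: "cn_step \<kappa> \<beta> hx hy s p q u u'" "cn_step \<kappa> \<beta> hx hy s q p v v'"
  shows "energy_form \<kappa> \<beta> Mx My hx hy u' v' p q (reflect (abs2 u') p) (reflect (abs2 v') q) =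
         energy_form \<kappa> \<beta> Mx My hx hy u v (reflect (abs2 u) p) (reflect (abs2 v) q) p q"
proof -
  let ?G = "ginner Mx My hx hy"
  let ?L = "\<lambda>w. A_h_inv Mx My hx hy (Lambda_h hx hy w)"
  have left: "?G (reflect (abs2 a) b) c = 2 * ?G c (abs2 a) - ?G c b"
    if "a \<in> cgrid Mx My" "b \<in> rgrid Mx My" "c \<in> rgrid Mx My" for a b c
    using ginner_commute_rgrid[OF reflect_rgrid[OF abs2_rgrid[OF that(1)] that(2)] that(3)]
    by (simp add: ginner_reflect_right)
  have pot: "?G (\<lambda>i j. a i j + of_real \<beta> * b i j) c = ?G a c + of_real \<beta> * ?G b c" for a b c
    using ginner_lincomb_left[of Mx My hx hy 1 a "of_real \<beta>" b c] by simp
  have "of_real \<kappa> * (?G (?L u') u' - ?G (?L u) u) =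
      ?G p (abs2 u) + of_real \<beta> * ?G q (abs2 u) - (?G p (abs2 u') + of_real \<beta> * ?G q (abs2 u'))"
    using cn_step_conservation(2)[OF pos uv(1,3) pq step(1), of hx hy] by (simp add: pot)
  moreover have "of_real \<kappa> * (?G (?L v') v' - ?G (?L v) v) =
      ?G q (abs2 v) + of_real \<beta> * ?G p (abs2 v) - (?G q (abs2 v') + of_real \<beta> * ?G p (abs2 v'))"
    using cn_step_conservation(2)[OF pos uv(2,4) pq(2,1) step(2), of hx hy] by (simp add: pot)
  moreover have "?G q p = ?G p q"
    by (rule ginner_commute_rgrid[OF pq(2,1)])
  ultimately have eqs: "of_real \<kappa> * ?G (?L u') u' = of_real \<kappa> * ?G (?L u) u +
      (?G p (abs2 u) + of_real \<beta> * ?G q (abs2 u) - (?G p (abs2 u') + of_real \<beta> * ?G q (abs2 u')))"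
    "of_real \<kappa> * ?G (?L v') v' = of_real \<kappa> * ?G (?L v) v +
      (?G q (abs2 v) + of_real \<beta> * ?G p (abs2 v) - (?G q (abs2 v') + of_real \<beta> * ?G p (abs2 v')))"
    "?G q p = ?G p q"
    by (simp_all add: algebra_simps)
  show ?thesis
    unfolding energy_form_def ginner_reflect_right left[OF uv(1) pq(1,1)] left[OF uv(2) pq(2,2)]
      left[OF uv(1) pq(1,2)] left[OF uv(2) pq(2,1)] minus_mult_left[symmetric] distrib_left eqs
    by (simp add: algebra_simps diff_divide_distrib add_divide_distrib)
qed

section \<open>Masses and the conservation laws of the scheme\<close>

text \<open>The weighted sum of squares is real and nonnegative, so squaring undoes the root in
  \<open>gnorm\<close>.\<close>

lemma of_real_mass:
  assumes "hx > 0" "hy > 0"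
  shows "complex_of_real (mass Mx My hx hy W n) = ginner Mx My hx hy (W n) (W n)"
proof -
  let ?g = "ginner Mx My hx hy (W n) (W n)"
  have "?g = of_real (hx * hy * (\<Sum>i = 1..int Mx. \<Sum>j = 1..int My. (cmod (W n i j))\<^sup>2))"
    by (simp add: ginner_def complex_norm_square[symmetric])
  moreover have "0 \<le> hx * hy * (\<Sum>i = 1..int Mx. \<Sum>j = 1..int My. (cmod (W n i j))\<^sup>2)"
    using assms by (simp add: sum_nonneg)
  ultimately show ?thesis
    by (simp add: mass_def gnorm_def)
qed

lemma ginner_abs2_grid_one: "ginner Mx My hx hy (abs2 w) grid_one = ginner Mx My hx hy w w"
  unfolding ginner_def abs2_def grid_one_def complex_norm_square by simp

theorem theorem2p9:
  fixes xl xr yl yr T \<kappa> \<beta> \<tau> hx hy :: real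
    and N Mx My :: nat
    and u0 v0 :: "real \<Rightarrow> real \<Rightarrow> complex"
    and U V \<Phi> \<Psi> :: "nat \<Rightarrow> grid_fun"
    and Uh Vh \<Phi>0 \<Psi>0 :: grid_fun
  assumes "xl < xr" and "yl < yr" and "T > 0"
    and "N > 0" and "Mx > 0" and "My > 0"
    and "\<tau> = T / real N" and "hx = (xr - xl) / real Mx" and "hy = (yr - yl) / real My"
    and "\<And>x y. u0 (x + (xr - xl)) y = u0 x y" and "\<And>x y. u0 x (y + (yr - yl)) = u0 x y"
    and "\<And>x y. v0 (x + (xr - xl)) y = v0 x y" and "\<And>x y. v0 x (y + (yr - yl)) = v0 x y"
    and "lrcd_scheme \<kappa> \<beta> N \<tau> Mx My hx hy
           (grid_values xl yl hx hy u0) (grid_values xl yl hx hy v0) U V Uh Vh \<Phi>0 \<Psi>0 \<Phi> \<Psi>"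
  shows "(\<forall>n. n + 1 \<le> N \<longrightarrow>
            mass Mx My hx hy U (n + 1) = mass Mx My hx hy U 0 \<and>
            mass Mx My hx hy V (n + 1) = mass Mx My hx hy V 0 \<and>
            energy \<kappa> \<beta> N Mx My hx hy U V \<Phi>0 \<Psi>0 \<Phi> \<Psi> (n + 1)
              = energy \<kappa> \<beta> N Mx My hx hy U V \<Phi>0 \<Psi>0 \<Phi> \<Psi> 0) \<and>
         (\<forall>n. n + 2 \<le> N \<longrightarrow>
            relaxed_mass Mx My hx hy \<Phi>0 \<Phi> (n + 1) = of_real (mass Mx My hx hy U 0) \<and>
            relaxed_mass Mx My hx hy \<Psi>0 \<Psi> (n + 1) = of_real (mass Mx My hx hy V 0))"
proof -
  have h: "hx > 0" "hy > 0" "\<tau> \<noteq> 0"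
    using assms by auto
  note pos = \<open>Mx > 0\<close> \<open>My > 0\<close> h(1,2)[THEN less_imp_neq, symmetric] h(3)
  have grid: "U n \<in> cgrid Mx My" "V n \<in> cgrid Mx My" if "n \<le> N" for n
    using assms(14) that by (auto simp: lrcd_scheme_def)
  have field: "\<Phi> n \<in> rgrid Mx My" "\<Psi> n \<in> rgrid Mx My" if "n < N" for n
    using assms(14) that by (auto simp: lrcd_scheme_def)
  have step: "cn_step \<kappa> \<beta> hx hy \<tau> (\<Phi> n) (\<Psi> n) (U n) (U (n + 1))"
    "cn_step \<kappa> \<beta> hx hy \<tau> (\<Psi> n) (\<Phi> n) (V n) (V (n + 1))" if "n < N" for n
    using assms(14) that by (auto simp: lrcd_scheme_def)
  have init: "\<Phi>0 = abs2 (U 0)" "\<Psi>0 = abs2 (V 0)"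
    using assms(14) by (auto simp: lrcd_scheme_def)
  have relax: "\<Phi> (n + 1) = reflect (abs2 (U (n + 1))) (\<Phi> n)"
    "\<Psi> (n + 1) = reflect (abs2 (V (n + 1))) (\<Psi> n)" if "n + 1 < N" for n
    using assms(14) that by (auto simp: lrcd_scheme_def)
  \<comment> \<open>Reflection in a fixed density is an involution, so the previous field is
    recovered from the current one.\<close>
  have relax': "reflect (abs2 (U (n + 1))) (\<Phi> (n + 1)) = \<Phi> n"
    "reflect (abs2 (V (n + 1))) (\<Psi> (n + 1)) = \<Psi> n" if "n + 1 < N" for n
    using relax[OF that] by (simp_all add: reflect_def)
  have mass_step: "mass Mx My hx hy U (n + 1) = mass Mx My hx hy U n"
    "mass Mx My hx hy V (n + 1) = mass Mx My hx hy V n" if "n < N" for n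
    using cn_step_conservation(1)[OF pos _ _ field[OF that] step(1)[OF that], of hx hy]
      cn_step_conservation(1)[OF pos _ _ field(2,1)[OF that] step(2)[OF that], of hx hy]
      grid[of n] grid[of "n + 1"] that
    by (simp_all add: mass_def gnorm_def)
  have mass: "mass Mx My hx hy U n = mass Mx My hx hy U 0 \<and>
      mass Mx My hx hy V n = mass Mx My hx hy V 0" if "n \<le> N" for n
    using that
  proof (induction n)
    case (Suc n)
    then show ?case
      using mass_step[of n] by simp
  qed simp
  let ?E = "energy \<kappa> \<beta> N Mx My hx hy U V \<Phi>0 \<Psi>0 \<Phi> \<Psi>"
  \<comment> \<open>Each interior energy has two readings: start of a step, with the earlier fields
    reflected, and end of a step, with the later ones reflected. Level 0 needs only the first, level
    \<open>N\<close> only the second.\<close>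
  have before: "?E n = energy_form \<kappa> \<beta> Mx My hx hy (U n) (V n)
      (reflect (abs2 (U n)) (\<Phi> n)) (reflect (abs2 (V n)) (\<Psi> n)) (\<Phi> n) (\<Psi> n)" if "n < N" for n
  proof (cases n)
    case 0
    then show ?thesis
      by (simp add: energy_def init)
  next
    case (Suc m)
    then show ?thesis
      using that relax'[of m] by (simp add: energy_def)
  qed
  have after: "?E (n + 1) = energy_form \<kappa> \<beta> Mx My hx hy (U (n + 1)) (V (n + 1)) (\<Phi> n) (\<Psi> n)
      (reflect (abs2 (U (n + 1))) (\<Phi> n)) (reflect (abs2 (V (n + 1))) (\<Psi> n))" if "n < N" for n
  proof (cases "n + 1 < N")
    case True
    then show ?thesis
      using relax[of n] by (simp add: energy_def)
  next
    case False
    then have "N = n + 1"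
      using that by simp
    then show ?thesis
      by (simp add: energy_def)
  qed
  have energy_step: "?E (n + 1) = ?E n" if "n < N" for n
    unfolding before[OF that] after[OF that]
    by (rule energy_form_step[OF pos _ _ _ _ field[OF that] step[OF that]]) (use grid that in auto)
  have energy: "?E n = ?E 0" if "n \<le> N" for n
    using that
  proof (induction n)
    case (Suc n)
    then show ?case
      using energy_step[of n] by simp
  qed simp
  \<comment> \<open>The vanishing last term only fits the sum to the linearity rule of
    \<open>ginner\<close>.\<close>
  have fields_mean: "(\<lambda>i j. \<Phi> (n + 1) i j + \<Phi> n i j) = (\<lambda>i j. 2 * abs2 (U (n + 1)) i j + 0 * \<Phi> n i j)"
    "(\<lambda>i j. \<Psi> (n + 1) i j + \<Psi> n i j) = (\<lambda>i j. 2 * abs2 (V (n + 1)) i j + 0 * \<Psi> n i j)"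
    if "n + 1 < N" for n
    using relax[OF that] by (simp_all add: reflect_def)
  have relaxed: "relaxed_mass Mx My hx hy \<Phi>0 \<Phi> (n + 1) = of_real (mass Mx My hx hy U (n + 1))"
    "relaxed_mass Mx My hx hy \<Psi>0 \<Psi> (n + 1) = of_real (mass Mx My hx hy V (n + 1))"
    if "n + 1 < N" for n
    unfolding relaxed_mass_def of_real_mass[OF h(1,2)] add_diff_cancel_right' fields_mean[OF that]
      ginner_lincomb_left ginner_abs2_grid_one
    by simp_all
  show ?thesis
  proof (intro conjI allI impI)
    fix n
    assume "n + 1 \<le> N"
    then show "mass Mx My hx hy U (n + 1) = mass Mx My hx hy U 0"
      "mass Mx My hx hy V (n + 1) = mass Mx My hx hy V 0" "?E (n + 1) = ?E 0"
      using mass energy by blast+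
  next
    fix n
    assume "n + 2 \<le> N"
    then have "n + 1 < N" "n + 1 \<le> N"
      by auto
    then show "relaxed_mass Mx My hx hy \<Phi>0 \<Phi> (n + 1) = of_real (mass Mx My hx hy U 0)"
      "relaxed_mass Mx My hx hy \<Psi>0 \<Psi> (n + 1) = of_real (mass Mx My hx hy V 0)"
      using relaxed mass by metis+
  qed
qed

end
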